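(* Let $a_2,a_3$ be integers with $1<a_2<a_3$, $A=\{1,a_2,a_3\}$, and let $h$ be a positive integer with $X(h)\ge a_3$. Then $X(h+1)=X(h)+a_3$.
   Context: An integer $x$ has an $h$-representation if $x=c_3a_3+c_2a_2+c_1$ with integers $c_1,c_2,c_3\ge0$ and $c_1+c_2+c_3\le h$. $X(h)$ (the $h$-range) is one less than the smallest positive integer with no $h$-representation. *)

theory Defs
  imports Main
begin

definition has_h_rep :: "nat \<Rightarrow> int \<Rightarrow> int \<Rightarrow> int \<Rightarrow> bool" where
  "has_h_rep h a2 a3 x \<longleftrightarrow>
     (\<exists>c1 c2 c3 :: nat. c1 + c2 + c3 \<le> h \<and>
        x = int c3 * a3 + int c2 * a2 + int c1)"

definition h_range :: "nat \<Rightarrow> int \<Rightarrow> int \<Rightarrow> int" where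
  "h_range h a2 a3 = int (LEAST n :: nat. 0 < n \<and> \<not> has_h_rep h a2 a3 (int n)) - 1"

end

theory Submission
  imports Defs
begin

text \<open>
  Only the upper bound for \<open>X(h + 1)\<close> is hard.  If \<open>N = X(h) + 1 + a3\<close> had an
  \<open>(h + 1)\<close>-representation, it could not use \<open>a3\<close>, so it would be of the form
  \<open>c2 * a2 + c1\<close>.  Let \<open>q = a3 div a2\<close>.  The number \<open>q * a2 - 1\<close> is below \<open>a3\<close>, so
  \<open>X(h) \<ge> a3\<close> forces \<open>q + a2 - 2 \<le> h\<close>.  Hence it suffices that every \<open>N \<ge> a3\<close> has a
  representation using \<open>a3\<close> of weight at most the maximum of its weight without \<open>a3\<close> and
  \<open>q + a2 - 1\<close>.  Among \<open>1 \<le> k \<le> N div a3\<close>, take \<open>k\<close> minimising the residue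
  \<open>e k = (N - k * a3) mod a2\<close>.  If the greedy representation with \<open>k\<close> copies of \<open>a3\<close> is heavier
  than the one with none, then \<open>D = e k - e 0 > q\<close>, and minimality forces \<open>e (i + k) = e i + D\<close>.
  The residues are then so sparse that packing disjoint intervals of length \<open>D\<close> into
  \<open>[e k, a2)\<close> bounds the weight by \<open>q + a2 - 1\<close>.
\<close>

section \<open>Greedy weights and the packing of residues\<close>

lemma div_add_mod_le_weight:
  fixes a x y :: int
  assumes "1 < a" "0 \<le> x" "0 \<le> y"
  shows "(x * a + y) div a + (x * a + y) mod a \<le> x + y"
proof -
  \<comment> \<open>Trading \<open>a\<close> ones for one copy of \<open>a\<close> never adds
    weight, so the greedy representation is the lightest.\<close>
  have "y div a \<le> y div a * a"
    using assms pos_imp_zdiv_nonneg_iff[of a y] by (simp add: mult_le_cancel_left1)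
  then have "y div a + y mod a \<le> y"
    using div_mult_mod_eq[of y a] by linarith
  then show ?thesis using assms by simp
qed

text \<open>The bound counts integers in \<open>[m, a)\<close>: each \<open>i\<close> with
  \<open>i + k \<le> K\<close> claims \<open>[e i, e i + D)\<close>, whose right end
  \<open>e (i + k)\<close> is still below \<open>a\<close>, and each of the last \<open>k\<close>
  indices claims one point.\<close>

lemma residue_packing:
  fixes e :: "nat \<Rightarrow> int" and a D :: int and k K :: nat
  assumes kK: "1 \<le> k" "k \<le> K" and D: "0 < D"
    and le: "\<And>i. 1 \<le> i \<Longrightarrow> i \<le> K \<Longrightarrow> m \<le> e i"
    and less: "\<And>i. e i < a"
    and shift: "\<And>i. 1 \<le> i \<Longrightarrow> i + k \<le> K \<Longrightarrow> e (i + k) = e i + D"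
    and gap: "\<And>i j. 1 \<le> i \<Longrightarrow> i < j \<Longrightarrow> j \<le> K \<Longrightarrow> e j < e i \<or> e i + D \<le> e j"
  shows "int (K - k) * D + int k \<le> a - m"
proof -
  define w where "w i = (if i + k \<le> K then D else 1)" for i
  define S where "S i = {e i ..< e i + w i}" for i
  have w: "1 \<le> w i" "w i \<le> D" for i using D by (auto simp: w_def)
  have notin: "e j \<notin> S i" if "1 \<le> i" "i \<le> K" "1 \<le> j" "j \<le> K" "i \<noteq> j" for i j
  proof (cases "i < j")
    case True
    then show ?thesis using gap[of i j] that w(2)[of i] by (auto simp: S_def)
  next
    case False
    then have ji: "j < i" using that by simp
    have ne: "e i < e j \<or> e j + D \<le> e i" using gap[of j i] ji that by simp
    show ?thesis
    proof (cases "i + k \<le> K")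
      case True
      \<comment> \<open>The right end of \<open>S i\<close> is itself the residue
        \<open>e (i + k)\<close>, so the gap between \<open>j\<close> and \<open>i + k\<close> keeps
        \<open>e j\<close> from lying strictly inside \<open>S i\<close>.\<close>
      have "e (i + k) < e j \<or> e j + D \<le> e (i + k)"
        using gap[of j "i + k"] ji that True by simp
      then show ?thesis using shift[of i] that True ne D by (auto simp: S_def w_def)
    next
      case False
      then show ?thesis using ne D by (auto simp: S_def w_def)
    qed
  qed
  \<comment> \<open>If two half-open intervals meet, the larger left end lies in both.\<close>
  have disj: "S i \<inter> S j = {}" if "i \<in> {1..K}" "j \<in> {1..K}" "i \<noteq> j" for i j
    using notin[of i j] notin[of j i] that w(1)[of i] w(1)[of j]
    by (auto simp: S_def)
  have sub: "(\<Union>i\<in>{1..K}. S i) \<subseteq> {m..<a}"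
  proof -
    have "S i \<subseteq> {m..<a}" if "1 \<le> i" "i \<le> K" for i
    proof -
      have "e i + w i \<le> a"
        using shift[of i] less[of i] less[of "i + k"] that by (auto simp: w_def)
      then show ?thesis using le[OF that] by (auto simp: S_def)
    qed
    then show ?thesis by (meson UN_least atLeastAtMost_iff)
  qed
  have "int (card (\<Union>i\<in>{1..K}. S i)) = (\<Sum>i\<in>{1..K}. w i)"
  proof -
    have "card (\<Union>i\<in>{1..K}. S i) = (\<Sum>i\<in>{1..K}. card (S i))"
      by (rule card_UN_disjoint) (use disj in \<open>auto simp: S_def\<close>)
    moreover have "int (card (S i)) = w i" for i
      using w(1)[of i] by (simp add: S_def)
    ultimately show ?thesis by simp
  qed
  moreover have "(\<Sum>i\<in>{1..K}. w i) = int (K - k) * D + int k"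
  proof -
    have "(\<Sum>i\<in>{1..K}. w i) = (\<Sum>i\<in>{1..K - k}. w i) + (\<Sum>i\<in>{K - k + 1..K}. w i)"
      using kK by (subst sum.union_disjoint[symmetric]) (auto intro!: sum.cong)
    also have "(\<Sum>i\<in>{1..K - k}. w i) = (\<Sum>i\<in>{1..K - k}. D)"
      using kK by (intro sum.cong) (auto simp: w_def)
    also have "(\<Sum>i\<in>{K - k + 1..K}. w i) = (\<Sum>i\<in>{K - k + 1..K}. 1)"
      using kK by (intro sum.cong) (auto simp: w_def)
    finally show ?thesis using kK by simp
  qed
  moreover have "card (\<Union>i\<in>{1..K}. S i) \<le> card {m..<a}"
    by (rule card_mono) (use sub in auto)
  moreover have "m < a" using le[of k] less[of k] kK by simp
  ultimately show ?thesis by simp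
qed

text \<open>From \<open>k\<close> to \<open>K\<close> the quotient drops by at most
  \<open>q + 1\<close> per step, while packing pushes \<open>e k\<close> below \<open>a\<close> by
  \<open>D \<ge> q + 1\<close> per step and by \<open>k\<close> more. These cancel, leaving the
  quotient at \<open>K\<close> plus \<open>a\<close>. \<open>K\<close> is arbitrary so that it may
  exceed \<open>N div b\<close> by one.\<close>

lemma weight_bound_at_min_residue:
  fixes a b N :: int and k K :: nat
  assumes a: "1 < a" "a < b"
    and kK: "1 \<le> k" "k \<le> K"
    and min: "\<And>i. 1 \<le> i \<Longrightarrow> i \<le> K \<Longrightarrow> (N - int k * b) mod a \<le> (N - int i * b) mod a"
    and gt: "N mod a < (N - int k * b) mod a"
    and heavy: "N div a + N mod a < int k + (N - int k * b) div a + (N - int k * b) mod a"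
    and last: "(N - int K * b) div a < b div a"
  shows "int k + (N - int k * b) div a + (N - int k * b) mod a \<le> b div a + a - 1"
proof -
  define e where "e i = (N - int i * b) mod a" for i :: nat
  define f where "f i = (N - int i * b) div a" for i :: nat
  define q where "q = b div a"
  define r where "r = b mod a"
  define D where "D = e k - e 0"
  have b: "b = q * a + r" by (simp add: q_def r_def)
  have r: "0 \<le> r" "r < a" using a by (auto simp: r_def)
  have q1: "1 \<le> q" using a by (simp add: q_def pos_imp_zdiv_pos_iff int_one_le_iff_zero_less)
  have fe: "f i * a + e i = N - int i * b" for i by (simp add: e_def f_def)
  have e: "0 \<le> e i" "e i < a" for i using a by (auto simp: e_def)
  have min': "e k \<le> e i" if "1 \<le> i" "i \<le> K" for i using min[OF that] by (simp add: e_def)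
  have D0: "0 < D" using gt by (simp add: D_def e_def)
  have heavy': "f 0 + e 0 < int k + f k + e k" using heavy by (simp add: e_def f_def)
  \<comment> \<open>Both differences are congruent to \<open>- j * b\<close> modulo
    \<open>a\<close>.\<close>
  have dvd: "a dvd (e (i + j) - e i) - (e j - e 0)" for i j
  proof -
    have "(e (i + j) - e i) - (e j - e 0) = (f i + f j - f 0 - f (i + j)) * a"
      using fe[of i] fe[of j] fe[of 0] fe[of "i + j"] by (simp add: algebra_simps)
    then show ?thesis by simp
  qed
  have Dq: "q + 1 \<le> D"
  proof -
    have eq: "(f 0 - f k - int k * q) * a = D + int k * r"
      using fe[of k] fe[of 0] by (simp add: b D_def algebra_simps)
    have "0 < D + int k * r" using D0 r by (simp add: add_pos_nonneg)
    then have "0 < f 0 - f k - int k * q" using eq a by (metis zero_less_mult_pos2 less_trans zero_less_one)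
    \<comment> \<open>The quotient falls by at least \<open>k * q + 1\<close>, so the total weight
      can grow only if the residue outweighs that loss.\<close>
    then have "int k * q - int k + 2 \<le> D" using heavy' by (simp add: D_def)
    moreover have "1 * (q - 1) \<le> int k * (q - 1)"
      using kK q1 by (intro mult_right_mono) auto
    ultimately show ?thesis by (simp add: algebra_simps)
  qed
  \<comment> \<open>The only other candidate, \<open>e i + D - a\<close>, would be smaller than the
    minimum \<open>e k\<close>.\<close>
  have shift: "e (i + k) = e i + D" if i: "1 \<le> i" "i + k \<le> K" for i
  proof -
    obtain t where t: "e (i + k) - e i - D = a * t"
      using dvd[of i k] unfolding D_def by (auto elim: dvdE)
    have "e k \<le> e (i + k)" using min'[of "i + k"] i by simp
    then have "a * (- 1) < a * t" using t e[of i] e[of 0] unfolding D_def by linarith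
    moreover have "a * t < a * 1" using t e[of i] e[of "i + k"] D0 by linarith
    ultimately have "t = 0" using a by (simp only: mult_less_cancel_left_pos)
    then show ?thesis using t by simp
  qed
  \<comment> \<open>A difference in \<open>[0, D)\<close> would be congruent to
    \<open>e (j - i) - e 0\<close>, which by minimality lies in \<open>[D, a)\<close>.\<close>
  have gap: "e j < e i \<or> e i + D \<le> e j" if i: "1 \<le> i" "i < j" "j \<le> K" for i j
  proof (rule ccontr)
    assume c: "\<not> ?thesis"
    obtain t where t: "(e j - e i) - (e (j - i) - e 0) = a * t"
      using dvd[of i "j - i"] i by (auto elim: dvdE)
    have m: "e k \<le> e (j - i)" using min'[of "j - i"] i by simp
    then have "a * t < a * 0" using t c unfolding D_def by linarith
    moreover have "a * (- 1) < a * t" using t c e[of "j - i"] e[of 0] by linarith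
    ultimately show False using a by (simp only: mult_less_cancel_left_pos)
  qed
  have pack: "int (K - k) * D + int k \<le> a - e k"
    by (rule residue_packing[where e = e])
      (use kK D0 min' e shift gap in auto)
  have "f k \<le> f K + int (K - k) * (q + 1)"
  proof -
    define L where "L = int (K - k)"
    have L: "int K = int k + L" "0 \<le> L" using kK by (auto simp: L_def)
    have "(f k - f K - L * q) * a = e K - e k + L * r"
      using fe[of k] fe[of K] by (simp add: b L algebra_simps)
    also have "\<dots> < a + L * a"
      using e[of K] e[of k] r L by (intro add_less_le_mono mult_left_mono) auto
    also have "\<dots> = (1 + L) * a" by (simp add: algebra_simps)
    finally have "f k - f K - L * q < 1 + L" using a by (simp add: mult_less_cancel_right_pos)
    then show ?thesis by (simp add: L_def algebra_simps)
  qed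
  moreover have "int (K - k) * (q + 1) \<le> int (K - k) * D"
    using Dq by (intro mult_left_mono) auto
  moreover have "f K < q" using last by (simp add: f_def q_def)
  ultimately have "int k + f k + e k \<le> q + a - 1" using pack by linarith
  then show ?thesis by (simp add: e_def f_def q_def)
qed

text \<open>The two entries of the maximum are the quantities later bounded by
  \<open>h + 1\<close>.\<close>

lemma exists_light_rep_with_a3:
  fixes a b N :: int
  assumes a: "1 < a" "a < b" and N: "b \<le> N"
  shows "\<exists>k::nat. 1 \<le> k \<and> int k * b \<le> N \<and>
    int k + (N - int k * b) div a + (N - int k * b) mod a
      \<le> max (N div a + N mod a) (b div a + a - 1)"
proof -
  define K where "K = nat (N div b)"
  have "1 \<le> N div b" using a N by (simp add: pos_imp_zdiv_pos_iff int_one_le_iff_zero_less)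
  then have K: "1 \<le> K" "int K = N div b" by (auto simp: K_def)
  have KN: "int K * b \<le> N" "N < int K * b + b"
    unfolding K(2) using a div_mult_mod_eq[of N b] pos_mod_bound[of b N] pos_mod_sign[of b N] by linarith+
  define e where "e i = (N - int i * b) mod a" for i :: nat
  define k where "k = arg_min_on e {1..K}"
  have kK: "1 \<le> k" "k \<le> K"
    using arg_min_if_finite(1)[of "{1..K}" e] K by (auto simp: k_def)
  have min: "e k \<le> e i" if "1 \<le> i" "i \<le> K" for i
    using arg_min_least[of "{1..K}" i e] that by (auto simp: k_def)
  have kN: "int k * b \<le> N"
    using KN(1) kK a mult_right_mono[of "int k" "int K" b] by linarith
  have "int k + (N - int k * b) div a + e k \<le> max (N div a + N mod a) (b div a + a - 1)"
  proof (cases "e k \<le> N mod a \<or> int k + (N - int k * b) div a + e k \<le> N div a + N mod a")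
    case True
    have "int k + (N - int k * b) div a + e k \<le> N div a + N mod a" if "e k \<le> N mod a"
    proof (rule ccontr)
      \<comment> \<open>\<open>k\<close> copies of \<open>b\<close> replace \<open>u\<close> copies
        of \<open>a\<close> and \<open>v \<ge> 0\<close> ones. Fewer than \<open>k\<close> summands
        of size at most \<open>a < b\<close> cannot add up to \<open>k * b\<close>.\<close>
      define u where "u = N div a - (N - int k * b) div a"
      define v where "v = N mod a - e k"
      assume "\<not> ?thesis"
      then have "(u + v) * a \<le> int k * a" using a by (intro mult_right_mono) (auto simp: u_def v_def)
      also have "\<dots> < int k * b" using a kK by simp
      also have "int k * b = u * a + v"
        using div_mult_mod_eq[of N a] div_mult_mod_eq[of "N - int k * b" a]
        by (simp add: u_def v_def e_def algebra_simps)
      finally have "v * a < v" by (simp add: algebra_simps)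
      moreover have "v * 1 \<le> v * a" using that a by (intro mult_left_mono) (auto simp: v_def)
      ultimately show False by simp
    qed
    then show ?thesis using True by auto
  next
    case False
    show ?thesis
    proof (cases "(N - int K * b) div a < b div a")
      case True
      then show ?thesis
        using weight_bound_at_min_residue[of a b k K N] a kK min False by (auto simp: e_def)
    next
      \<comment> \<open>Here one more, virtual step beyond \<open>N div b\<close> still respects the minimality of \<open>e k\<close>.\<close>
      case ge: False
      define R where "R = N - int K * b"
      have R: "0 \<le> R" "R < b" using KN by (auto simp: R_def)
      have eq: "R div a = b div a"
        using ge zdiv_mono1[of R b a] R a by (auto simp: R_def)
      then have less: "R mod a < b mod a"
        using R div_mult_mod_eq[of R a] div_mult_mod_eq[of b a] unfolding eq by linarith
      \<comment> \<open>\<open>R\<close> and \<open>b\<close> have the same quotient by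
        \<open>a\<close>, so \<open>R - b\<close> lies strictly between \<open>- a\<close> and
        \<open>0\<close>. The virtual residue thus wraps around and exceeds \<open>e K\<close>, and
        the quotient \<open>- 1\<close> is below \<open>b div a\<close>.\<close>
      have "R - b = a * (- 1) + (R mod a + a - b mod a)"
        using div_mult_mod_eq[of R a] div_mult_mod_eq[of b a] unfolding eq by linarith
      moreover have "0 \<le> R mod a + a - b mod a" "R mod a + a - b mod a < a"
        using less a pos_mod_bound[of a b] pos_mod_sign[of a R] by linarith+
      ultimately have step: "(R - b) mod a = R mod a + a - b mod a" "(R - b) div a = - 1"
        by (rule int_mod_pos_eq, rule int_div_pos_eq)
      have eS: "e (Suc K) = R mod a + a - b mod a" and fS: "(N - int (Suc K) * b) div a = - 1"
        using step by (simp_all add: e_def R_def algebra_simps)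
      have "e K \<le> e (Suc K)" unfolding eS using a pos_mod_bound[of a b] by (simp add: e_def R_def less_imp_le)
      then have "e k \<le> e i" if "1 \<le> i" "i \<le> Suc K" for i
        using min[of i] min[of K] K(1) that by (cases "i = Suc K") auto
      moreover have "- 1 < b div a" using a pos_imp_zdiv_nonneg_iff[of a b] by linarith
      ultimately show ?thesis
        using weight_bound_at_min_residue[of a b k "Suc K" N] a kK False fS by (auto simp: e_def)
    qed
  qed
  then show ?thesis using kK(1) kN by (auto simp: e_def)
qed

section \<open>Passing between \<open>h\<close> and \<open>h + 1\<close> summands\<close>

lemma has_h_rep_add_a3:
  assumes "has_h_rep h a2 a3 x"
  shows "has_h_rep (h + 1) a2 a3 (x + a3)"
proof -
  obtain c1 c2 c3 where c: "c1 + c2 + c3 \<le> h" "x = int c3 * a3 + int c2 * a2 + int c1"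
    using assms by (auto simp: has_h_rep_def)
  have "c1 + c2 + Suc c3 \<le> h + 1" "x + a3 = int (Suc c3) * a3 + int c2 * a2 + int c1"
    using c by (auto simp: algebra_simps)
  then show ?thesis unfolding has_h_rep_def by blast
qed

lemma has_h_rep_mono:
  assumes "has_h_rep h a2 a3 x" "h \<le> h'"
  shows "has_h_rep h' a2 a3 x"
  using assms unfolding has_h_rep_def by (blast intro: order_trans)

text \<open>Every summand is at most \<open>a3\<close>. This guarantees that the
  \<open>LEAST\<close> in \<open>h_range\<close> ranges over a nonempty set.\<close>

lemma has_h_rep_le:
  fixes a2 a3 x :: int
  assumes "1 < a2" "a2 < a3" "has_h_rep h a2 a3 x"
  shows "x \<le> int h * a3"
proof -
  obtain c1 c2 c3 where c: "c1 + c2 + c3 \<le> h" "x = int c3 * a3 + int c2 * a2 + int c1"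
    using assms by (auto simp: has_h_rep_def)
  have "int c2 * a2 \<le> int c2 * a3" "int c1 * 1 \<le> int c1 * a3"
    using assms by (intro mult_left_mono; simp)+
  then have "x \<le> int (c1 + c2 + c3) * a3" using c by (simp add: algebra_simps)
  also have "\<dots> \<le> int h * a3" using c assms by (intro mult_right_mono) auto
  finally show ?thesis .
qed

lemma has_h_rep_remove_a3:
  fixes a2 a3 x :: int
  assumes a: "1 < a2" "a2 < a3"
    and small: "\<And>y. 0 < y \<Longrightarrow> y < a3 \<Longrightarrow> has_h_rep h a2 a3 y"
    and x: "0 \<le> x" and rep: "has_h_rep (h + 1) a2 a3 (x + a3)"
  shows "has_h_rep h a2 a3 x"
proof -
  obtain c1 c2 c3 where c: "c1 + c2 + c3 \<le> h + 1" "x + a3 = int c3 * a3 + int c2 * a2 + int c1"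
    using rep by (auto simp: has_h_rep_def)
  define N where "N = x + a3"
  define q where "q = a3 div a2"
  have "\<exists>c1 c2 c3. 0 < c3 \<and> c1 + c2 + c3 \<le> h + 1 \<and> N = int c3 * a3 + int c2 * a2 + int c1"
  proof (cases "c3 = 0")
    case False
    then show ?thesis using c by (auto simp: N_def)
  next
    case True
    have N: "N div a2 + N mod a2 \<le> int h + 1"
      using div_add_mod_le_weight[of a2 "int c2" "int c1"] a c True by (simp add: N_def)
    have q1: "1 \<le> q" using a by (simp add: q_def pos_imp_zdiv_pos_iff int_one_le_iff_zero_less)
    have qa: "q * a2 \<le> a3"
      unfolding q_def using a div_mult_mod_eq[of a3 a2] pos_mod_sign[of a2 a3] by linarith
    have "1 * a2 \<le> q * a2" using q1 a by (intro mult_right_mono) auto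
    then have "0 < q * a2 - 1" "q * a2 - 1 < a3" using a qa by linarith+
    then obtain d1 d2 d3 where d: "d1 + d2 + d3 \<le> h"
        "q * a2 - 1 = int d3 * a3 + int d2 * a2 + int d1"
      using small[of "q * a2 - 1"] by (auto simp: has_h_rep_def)
    have "d3 = 0"
    proof (rule ccontr)
      assume "d3 \<noteq> 0"
      then have "1 * a3 \<le> int d3 * a3" using a by (intro mult_right_mono) auto
      moreover have "0 \<le> int d2 * a2" using a by simp
      ultimately show False using d qa by simp
    qed
    \<comment> \<open>The greedy digits of this number are \<open>q - 1\<close> and
      \<open>a2 - 1\<close>, so \<open>q + a2 - 2 \<le> h\<close>.\<close>
    have "(q * a2 - 1) div a2 + (q * a2 - 1) mod a2 \<le> int h"
      using div_add_mod_le_weight[of a2 "int d2" "int d1"] a d \<open>d3 = 0\<close> by simp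
    moreover have "q * a2 - 1 = (q - 1) * a2 + (a2 - 1)" by (simp add: algebra_simps)
    moreover have "((q - 1) * a2 + (a2 - 1)) div a2 = q - 1"
      "((q - 1) * a2 + (a2 - 1)) mod a2 = a2 - 1"
      using a by (simp_all add: div_pos_pos_trivial mod_pos_pos_trivial del: minus_mod_self1)
    ultimately have qh: "q + a2 - 1 \<le> int h + 1" by simp
    obtain k :: nat where k: "1 \<le> k" "int k * a3 \<le> N"
        "int k + (N - int k * a3) div a2 + (N - int k * a3) mod a2 \<le> int h + 1"
      using exists_light_rep_with_a3[of a2 a3 N] a x N qh by (auto simp: N_def q_def)
    define f where "f = nat ((N - int k * a3) div a2)"
    define e where "e = nat ((N - int k * a3) mod a2)"
    have fe: "int f = (N - int k * a3) div a2" "int e = (N - int k * a3) mod a2"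
      using k a by (auto simp: f_def e_def pos_imp_zdiv_nonneg_iff)
    have "N = int k * a3 + int f * a2 + int e"
      using div_mult_mod_eq[of "N - int k * a3" a2] unfolding fe by linarith
    moreover have "e + f + k \<le> h + 1" using k(3) unfolding fe[symmetric] by linarith
    ultimately show ?thesis using k(1) by (metis less_eq_Suc_le One_nat_def)
  qed
  then obtain c1 c2 c3 where c': "0 < c3" "c1 + c2 + c3 \<le> h + 1"
      "N = int c3 * a3 + int c2 * a2 + int c1" by blast
  then have "c1 + c2 + (c3 - 1) \<le> h" "x = int (c3 - 1) * a3 + int c2 * a2 + int c1"
    by (auto simp: N_def of_nat_diff algebra_simps)
  then show ?thesis unfolding has_h_rep_def by blast
qed

theorem theorem3:
  fixes a2 a3 :: int and h :: nat
  assumes "1 < a2" and "a2 < a3" and "0 < h"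
    and "h_range h a2 a3 \<ge> a3"
  shows "h_range (h + 1) a2 a3 = h_range h a2 a3 + a3"
proof -
  define P where "P n \<longleftrightarrow> 0 < n \<and> \<not> has_h_rep h a2 a3 (int n)" for n :: nat
  define n where "n = (LEAST n. P n)"
  have "\<not> has_h_rep h a2 a3 (int (nat (int h * a3 + 1)))"
    using has_h_rep_le[OF assms(1,2), of h "int h * a3 + 1"] assms(1,2) by auto
  moreover have "0 < nat (int h * a3 + 1)"
    using assms(1,2) by (simp add: add_nonneg_pos)
  ultimately have "P (nat (int h * a3 + 1))" by (simp only: P_def simp_thms)
  then have n: "0 < n" "\<not> has_h_rep h a2 a3 (int n)"
    using LeastI[of P] unfolding n_def[symmetric] by (auto simp only: P_def)
  have below: "has_h_rep h a2 a3 y" if "0 \<le> y" "y < int n" for y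
  proof (cases "y = 0")
    case True
    then show ?thesis by (auto simp: has_h_rep_def intro!: exI[of _ 0])
  next
    case False
    then show ?thesis using not_less_Least[of "nat y" P] that by (auto simp: n_def P_def)
  qed
  have range: "h_range h a2 a3 = int n - 1" by (simp add: h_range_def n_def P_def)
  with assms(4) have na: "a3 < int n" by simp
  define d where "d = nat a3"
  have d: "int d = a3" using assms by (simp add: d_def)
  have "(LEAST m :: nat. 0 < m \<and> \<not> has_h_rep (h + 1) a2 a3 (int m)) = n + d"
  proof (rule Least_equality)
    have "\<not> has_h_rep (h + 1) a2 a3 (int n + a3)"
      using has_h_rep_remove_a3[OF assms(1,2), of h "int n"] below na n by fastforce
    then show "0 < n + d \<and> \<not> has_h_rep (h + 1) a2 a3 (int (n + d))"
      using n d by simp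
  next
    fix m :: nat
    assume m: "0 < m \<and> \<not> has_h_rep (h + 1) a2 a3 (int m)"
    show "n + d \<le> m"
    proof (rule ccontr)
      assume "\<not> n + d \<le> m"
      then have less: "int m < int n + a3" using d by simp
      \<comment> \<open>Below \<open>n\<close> the old representation serves. From \<open>n\<close>
        up to \<open>n + a3 - 1\<close>, subtracting \<open>a3\<close> leaves a positive number
        below \<open>n\<close>, and one copy of \<open>a3\<close> is added back.\<close>
      show False
      proof (cases "int m < int n")
        case True
        then show False using m below[of "int m"] has_h_rep_mono[of h a2 a3 "int m" "h + 1"] by simp
      next
        case False
        then show False
          using m below[of "int m - a3"] has_h_rep_add_a3[of h a2 a3 "int m - a3"] less na by simp
      qed
    qed
  qed
  then show ?thesis using range d by (simp add: h_range_def)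
qed

end
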